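(* Let $B\in\mathbb{R}^{n\times n}$ be the cubic B-spline collocation matrix associated with parameters $t_1<t_2<\cdots<t_n$, and let $Q=I+S$ be the preconditioner, where $S$ carries the negatives of the super-diagonal entries of $B$ (both as defined in the context). Write $QB=D_{QB}-L_{QB}-U_{QB}$, where $D_{QB}$, $-L_{QB}$, $-U_{QB}$ are respectively the diagonal, strictly lower triangular and strictly upper triangular parts of $QB$. Then the preconditioned GS--PIA $$\boldsymbol{p}^{(k+1)}=(D_{QB}-L_{QB})^{-1}U_{QB}\,\boldsymbol{p}^{(k)}+(D_{QB}-L_{QB})^{-1}Q\boldsymbol{p},\qquad k=0,1,2,\ldots,$$ is convergent, i.e. its iteration matrix satisfies $\rho\left((D_{QB}-L_{QB})^{-1}U_{QB}\right)<1$.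
   Context: Data: points $\boldsymbol{p}_1,\ldots,\boldsymbol{p}_n$ in $\mathbb{R}^2$ or $\mathbb{R}^3$ with parameters $t_1<t_2<\cdots<t_n$. Extend the parameters to the knot vector $\{t_i\}_{i=-2}^{n+3}$ with $t_{-2}=t_{-1}=t_0=t_1<t_2<\cdots<t_n=t_{n+1}=t_{n+2}=t_{n+3}$. Let $\{N_i^3(t)\}_{i=-2}^{n-1}$ be the (normalized) cubic B-spline basis on this knot vector, where $N_i^3$ has support $[t_i,t_{i+4}]$. Collocation matrix: $B=(b_{ij})\in\mathbb{R}^{n\times n}$ is the tridiagonal matrix with $b_{11}=1$, $b_{12}=0$, $b_{n,n-1}=0$, $b_{nn}=1$, and for $2\le i\le n-1$: $b_{i,i-1}=N_{i-3}^3(t_i)$, $b_{ii}=N_{i-2}^3(t_i)$, $b_{i,i+1}=N_{i-1}^3(t_i)$; all other entries are $0$. Preconditioner: $Q=I+S$, where $S$ has entries $S_{i,i+1}=-b_{i,i+1}$ for $1\le i\le n-1$ (so $S_{12}=0$) and all other entries $0$. The diagonal entries of $QB$ are positive, so the lower triangular matrix $D_{QB}-L_{QB}$ is invertible. Write $\boldsymbol{p}=[\boldsymbol{p}_1,\ldots,\boldsymbol{p}_n]^T$ (one data point per row), and $\boldsymbol{p}^{(k)}=[\boldsymbol{p}_1^{(k)},\ldots,\boldsymbol{p}_n^{(k)}]^T$ for the control points at step $k$. $\rho(\cdot)$ is the spectral radius. A stationary iteration $\boldsymbol{x}^{(k+1)}=G\boldsymbol{x}^{(k)}+\boldsymbol{c}$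 is called convergent if its iteration matrix $G$ satisfies $\rho(G)<1$ (equivalently, the iterates converge for every initial guess and every $\boldsymbol{c}$). *)

theory Defs
  imports
    "Jordan_Normal_Form.Spectral_Radius"
    "Jordan_Normal_Form.Gauss_Jordan_Elimination"
begin

text \<open>Clamped knot sequence: the parameters \<open>t 1 < \<dots> < t n\<close>, with the first and the last one
  repeated. Only the indices \<open>-2, \<dots>, n + 3\<close> are relevant.\<close>

definition knot :: "nat \<Rightarrow> (nat \<Rightarrow> real) \<Rightarrow> int \<Rightarrow> real" where
  "knot n t i = (if i \<le> 1 then t 1 else if i \<ge> int n then t n else t (nat i))"

text \<open>Normalized B-splines by the Cox--de Boor recursion; \<open>bspline u k i\<close> has degree \<open>k\<close> and support
  \<open>[u i, u (i + k + 1)]\<close>. At repeated knots the usual convention \<open>a / 0 = 0\<close> applies, which is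
  division by zero in HOL. With half-open intervals in degree 0 all the functions vanish at the
  last knot; below they are evaluated at interior knots only.\<close>

fun bspline :: "(int \<Rightarrow> real) \<Rightarrow> nat \<Rightarrow> int \<Rightarrow> real \<Rightarrow> real" where
  "bspline u 0 i x = (if u i \<le> x \<and> x < u (i + 1) then 1 else 0)"
| "bspline u (Suc k) i x =
     (x - u i) / (u (i + int k + 1) - u i) * bspline u k i x
     + (u (i + int k + 2) - x) / (u (i + int k + 2) - u (i + 1)) * bspline u k (i + 1) x"

text \<open>The entry \<open>b\<^sub>i\<^sub>j\<close> for 1-based indices \<open>i\<close> and \<open>j\<close>.\<close>

definition collocation_entry :: "nat \<Rightarrow> (nat \<Rightarrow> real) \<Rightarrow> nat \<Rightarrow> nat \<Rightarrow> real" where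
  "collocation_entry n t i j =
     (if i = 1 \<or> i = n then (if j = i then 1 else 0)
      else if j + 1 = i then bspline (knot n t) 3 (int i - 3) (t i)
      else if j = i then bspline (knot n t) 3 (int i - 2) (t i)
      else if j = i + 1 then bspline (knot n t) 3 (int i - 1) (t i)
      else 0)"

text \<open>The indices of \<open>mat\<close> start at 0.\<close>

definition collocation_mat :: "nat \<Rightarrow> (nat \<Rightarrow> real) \<Rightarrow> real mat" where
  "collocation_mat n t = mat n n (\<lambda>(i, j). collocation_entry n t (i + 1) (j + 1))"

definition super_diag_mat :: "nat \<Rightarrow> (nat \<Rightarrow> real) \<Rightarrow> real mat" where
  "super_diag_mat n t =
     mat n n (\<lambda>(i, j). if j = i + 1 then - collocation_mat n t $$ (i, j) else 0)"

definition precond_mat :: "nat \<Rightarrow> (nat \<Rightarrow> real) \<Rightarrow> real mat" where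
  "precond_mat n t = 1\<^sub>m n + super_diag_mat n t"

text \<open>The splitting \<open>A = D - L - U\<close>; note the signs of \<open>L\<close> and \<open>U\<close>.\<close>

definition split_D :: "real mat \<Rightarrow> real mat" where
  "split_D A = mat (dim_row A) (dim_col A) (\<lambda>(i, j). if i = j then A $$ (i, j) else 0)"

definition split_L :: "real mat \<Rightarrow> real mat" where
  "split_L A = mat (dim_row A) (dim_col A) (\<lambda>(i, j). if j < i then - A $$ (i, j) else 0)"

definition split_U :: "real mat \<Rightarrow> real mat" where
  "split_U A = mat (dim_row A) (dim_col A) (\<lambda>(i, j). if i < j then - A $$ (i, j) else 0)"

lemma split_D_L_U: "A = split_D A - split_L A - split_U A"
  by (rule eq_matI) (auto simp: split_D_def split_L_def split_U_def)

text \<open>The inverse of an invertible matrix; unspecified for a singular one.\<close>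

definition inv_mat :: "real mat \<Rightarrow> real mat" where
  "inv_mat A = the (mat_inverse A)"

lemma inv_mat:
  assumes A: "A \<in> carrier_mat n n" and inv: "invertible_mat A"
  shows "inv_mat A \<in> carrier_mat n n" "A * inv_mat A = 1\<^sub>m n" "inv_mat A * A = 1\<^sub>m n"
proof -
  obtain B where AB: "A * B = 1\<^sub>m n" and BA: "B * A = 1\<^sub>m (dim_row B)"
    using inv A by (auto simp: invertible_mat_def inverts_mat_def)
  have "dim_col (A * B) = n" "dim_col (B * A) = dim_row B"
    using AB BA by simp_all
  then have B: "B \<in> carrier_mat n n"
    using A by auto
  have "A \<in> Units (ring_mat TYPE(real) n ())"
    using A B AB BA by (auto simp: Units_def ring_mat_def intro!: bexI[of _ B])
  then obtain C where "mat_inverse A = Some C"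
    using mat_inverse(1)[OF A, where b = "()"] by (cases "mat_inverse A") auto
  then show "inv_mat A \<in> carrier_mat n n" "A * inv_mat A = 1\<^sub>m n" "inv_mat A * A = 1\<^sub>m n"
    using mat_inverse(2)[OF A] by (auto simp: inv_mat_def)
qed

end

theory Submission
  imports Defs
begin

text \<open>
  The collocation matrix \<open>B\<close> need not be diagonally dominant: if \<open>t (i - 2)\<close>, \<open>t (i - 1)\<close> and
  \<open>t i\<close> are close together and \<open>t (i + 1)\<close> is far away, then \<open>b\<^sub>i\<^sub>,\<^sub>i\<^sub>-\<^sub>1\<close> is nearly 1 and
  \<open>b\<^sub>i\<^sub>i\<close> nearly 0. It is, however, strictly diagonally dominant after a positive scaling of its
  columns, and the scaling is explicit: with \<open>x\<^sub>i = t (i + 1) - t (i - 1)\<close> one has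
  \<open>b\<^sub>i\<^sub>,\<^sub>i\<^sub>-\<^sub>1 x\<^sub>i\<^sub>-\<^sub>1 + b\<^sub>i\<^sub>,\<^sub>i\<^sub>+\<^sub>1 x\<^sub>i\<^sub>+\<^sub>1 < b\<^sub>i\<^sub>i x\<^sub>i\<close> in every interior row. The Cox--de Boor recursion
  writes \<open>b\<^sub>i\<^sub>i\<close> as a sum of two terms, and multiplied by \<open>x\<^sub>i\<close> the first of them outweighs the left
  neighbour and the second the right one (\<open>bspline_row_dominant\<close>).

  The preconditioner replaces row \<open>i\<close> by row \<open>i\<close> minus \<open>b\<^sub>i\<^sub>,\<^sub>i\<^sub>+\<^sub>1\<close> times row \<open>i + 1\<close>. For a
  nonnegative matrix with diagonal at most 1 this keeps dominance with the same weights: the excess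
  of the new row is at least the excess of the old row \<open>i\<close> plus \<open>b\<^sub>i\<^sub>,\<^sub>i\<^sub>+\<^sub>1\<close> times the excess of the
  old row \<open>i + 1\<close> (\<open>weighted_dominant_precond\<close>).

  Finally, the Gauss--Seidel iteration of a matrix that is dominant with weights \<open>x\<close> converges: if
  \<open>U v = e (D - L) v\<close> with \<open>\<bar>e\<bar> \<ge> 1\<close>, then comparing moduli in the row where \<open>\<bar>v\<^sub>i\<bar> / x\<^sub>i\<close> is largest
  contradicts dominance (\<open>gauss_seidel_eigenvalue_norm_less_1\<close>).
\<close>

section \<open>Gauss--Seidel iteration under weighted diagonal dominance\<close>

text \<open>Strict row diagonal dominance of \<open>A\<close> times the diagonal matrix of \<open>x\<close>; for positive \<open>x\<close> this is
  the notion of a (nonsingular) H-matrix, with \<open>x\<close> as a witness.\<close>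

definition weighted_dominant :: "nat \<Rightarrow> (nat \<Rightarrow> real) \<Rightarrow> real mat \<Rightarrow> bool" where
  "weighted_dominant n x A \<longleftrightarrow>
     (\<forall>i<n. (\<Sum>j\<in>{..<n} - {i}. \<bar>A $$ (i, j)\<bar> * x j) < \<bar>A $$ (i, i)\<bar> * x i)"

lemma weighted_dominant_diag_nonzero:
  assumes "weighted_dominant n x A" "\<And>i. i < n \<Longrightarrow> x i > 0" "i < n"
  shows "A $$ (i, i) \<noteq> 0"
proof
  assume "A $$ (i, i) = 0"
  then have "(\<Sum>j\<in>{..<n} - {i}. \<bar>A $$ (i, j)\<bar> * x j) < 0"
    using assms unfolding weighted_dominant_def by fastforce
  moreover have "(\<Sum>j\<in>{..<n} - {i}. \<bar>A $$ (i, j)\<bar> * x j) \<ge> 0"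
    using assms(2) by (intro sum_nonneg mult_nonneg_nonneg) (auto simp: less_imp_le)
  ultimately show False by simp
qed

text \<open>The matrix \<open>D - L\<close> is the lower triangular part of \<open>A\<close>, so its determinant is the product of
  the diagonal entries of \<open>A\<close>.\<close>

lemma split_D_minus_L_inverse:
  assumes A: "A \<in> carrier_mat n n" and nz: "\<And>i. i < n \<Longrightarrow> A $$ (i, i) \<noteq> 0"
  shows "inv_mat (split_D A - split_L A) \<in> carrier_mat n n"
    "(split_D A - split_L A) * inv_mat (split_D A - split_L A) = 1\<^sub>m n"
proof -
  let ?T = "split_D A - split_L A"
  have T: "?T \<in> carrier_mat n n"
    using A by (auto simp: split_D_def split_L_def)
  have "det ?T = prod_list (diag_mat ?T)"
    by (rule det_lower_triangular[OF _ T]) (use A in \<open>auto simp: split_D_def split_L_def\<close>)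
  moreover have "0 \<notin> set (diag_mat ?T)"
    using A nz by (auto simp: diag_mat_def split_D_def split_L_def)
  ultimately have "det ?T \<noteq> 0"
    by (simp add: prod_list_zero_iff)
  then have "?T \<in> Units (ring_mat TYPE(real) n ())"
    by (rule det_non_zero_imp_unit[OF T])
  then obtain C where "C \<in> carrier_mat n n" "C * ?T = 1\<^sub>m n" "?T * C = 1\<^sub>m n"
    by (auto simp: Units_def ring_mat_def)
  then have "invertible_mat ?T"
    using T A by (auto simp: invertible_mat_def inverts_mat_def split_L_def)
  from inv_mat[OF T this]
  show "inv_mat ?T \<in> carrier_mat n n" "?T * inv_mat ?T = 1\<^sub>m n"
    by auto
qed

text \<open>The equation says that \<open>e\<close> is an eigenvalue of \<open>(D - L)\<^sup>-\<^sup>1 U\<close>, multiplied through by \<open>D - L\<close> so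
  that no entry of an inverse has to be estimated. Its row \<open>i\<close> expresses \<open>e a\<^sub>i\<^sub>i v\<^sub>i\<close> by the other
  \<open>v\<^sub>j\<close>, with factor \<open>1\<close> above the diagonal and \<open>e\<close> below it; if \<open>\<bar>e\<bar> \<ge> 1\<close>, both factors are bounded
  by \<open>\<bar>e\<bar>\<close>, which then cancels.\<close>

lemma gauss_seidel_eigenvalue_norm_less_1:
  fixes A :: "real mat" and v :: "complex vec"
  assumes A: "A \<in> carrier_mat n n" and v: "v \<in> carrier_vec n" "v \<noteq> 0\<^sub>v n"
    and x: "\<And>i. i < n \<Longrightarrow> x i > 0" and dom: "weighted_dominant n x A"
    and eq: "map_mat complex_of_real (split_U A) *\<^sub>v v =
      e \<cdot>\<^sub>v (map_mat complex_of_real (split_D A - split_L A) *\<^sub>v v)"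
  shows "cmod e < 1"
proof (rule ccontr)
  assume "\<not> cmod e < 1"
  then have e: "cmod e \<ge> 1" by simp
  \<comment> \<open>The row to look at is one that maximizes the modulus of \<open>v\<close> relative to the weights.\<close>
  define r where "r = (\<lambda>i. cmod (v $ i) / x i)"
  obtain k where k: "k < n" "v $ k \<noteq> 0"
    using v by (metis carrier_vecD eq_vecI index_zero_vec)
  define m where "m = Max (r ` {..<n})"
  have "m \<in> r ` {..<n}"
    unfolding m_def using k by (intro Max_in) auto
  then obtain i where i: "i < n" "m = r i"
    by auto
  have le: "r j \<le> m" if "j < n" for j
    unfolding m_def using that by (intro Max_ge) auto
  have "m > 0"
    using k x[OF k(1)] by (intro less_le_trans[OF _ le[OF k(1)]]) (simp add: r_def)
  have vi: "cmod (v $ i) = m * x i"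
    using i x[of i] by (simp add: r_def)
  have vj: "cmod (v $ j) \<le> m * x j" if "j < n" for j
    using le[OF that] x[OF that] by (simp add: r_def field_simps)
  have U: "(map_mat complex_of_real (split_U A) *\<^sub>v v) $ i =
      (\<Sum>j<n. if i < j then - of_real (A $$ (i, j)) * v $ j else 0)"
    using A v i by (auto simp: scalar_prod_def split_U_def lessThan_atLeast0 intro!: sum.cong)
  have DL: "(map_mat complex_of_real (split_D A - split_L A) *\<^sub>v v) $ i =
      (\<Sum>j<n. if j \<le> i then of_real (A $$ (i, j)) * v $ j else 0)"
    using A v i
    by (auto simp: scalar_prod_def split_D_def split_L_def lessThan_atLeast0 intro!: sum.cong)
  let ?d = "of_real (A $$ (i, i)) * v $ i"
  \<comment> \<open>The summands of row \<open>i\<close> of \<open>U v - e (D - L) v\<close>, which add up to 0.\<close>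
  define w where
    "w = (\<lambda>j. (if i < j then - 1 else - e) * (of_real (A $$ (i, j)) * v $ j))"
  have "(\<Sum>j<n. if i < j then - of_real (A $$ (i, j)) * v $ j else 0) =
      e * (\<Sum>j<n. if j \<le> i then of_real (A $$ (i, j)) * v $ j else 0)"
    using arg_cong[OF eq, of "\<lambda>y. y $ i"] A i unfolding U[symmetric] DL[symmetric]
    by (simp add: split_D_def split_L_def)
  then have "0 = (\<Sum>j<n. (if i < j then - of_real (A $$ (i, j)) * v $ j else 0)
      - e * (if j \<le> i then of_real (A $$ (i, j)) * v $ j else 0))"
    by (simp add: sum_subtractf sum_distrib_left)
  also have "\<dots> = (\<Sum>j<n. w j)"
    by (rule sum.cong) (auto simp: w_def)
  also have "\<dots> = w i + (\<Sum>j\<in>{..<n} - {i}. w j)"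
    using i by (intro sum.remove) auto
  finally have "e * ?d = (\<Sum>j\<in>{..<n} - {i}. w j)"
    by (simp add: w_def)
  then have "cmod e * (\<bar>A $$ (i, i)\<bar> * (m * x i)) = cmod (\<Sum>j\<in>{..<n} - {i}. w j)"
    by (metis vi norm_mult norm_of_real)
  also have "\<dots> \<le> (\<Sum>j\<in>{..<n} - {i}. cmod e * (\<bar>A $$ (i, j)\<bar> * (m * x j)))"
  proof (rule sum_norm_le)
    fix j assume "j \<in> {..<n} - {i}"
    then have 1: "\<bar>A $$ (i, j)\<bar> * cmod (v $ j) \<le> \<bar>A $$ (i, j)\<bar> * (m * x j)"
      by (intro mult_left_mono vj) auto
    have 2: "cmod (if i < j then - 1 else - e) \<le> cmod e"
      using e by simp
    show "cmod (w j) \<le> cmod e * (\<bar>A $$ (i, j)\<bar> * (m * x j))"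
      unfolding w_def norm_mult norm_of_real by (rule mult_mono[OF 2 1]) auto
  qed
  also have "\<dots> = cmod e * m * (\<Sum>j\<in>{..<n} - {i}. \<bar>A $$ (i, j)\<bar> * x j)"
    by (simp add: sum_distrib_left mult_ac)
  also have "\<dots> < cmod e * m * (\<bar>A $$ (i, i)\<bar> * x i)"
    using dom i \<open>m > 0\<close> e unfolding weighted_dominant_def
    by (intro mult_strict_left_mono mult_pos_pos) auto
  finally show False by (simp add: mult_ac)
qed

theorem gauss_seidel_spectral_radius_less_1:
  assumes A: "A \<in> carrier_mat n n" and n: "n > 0"
    and x: "\<And>i. i < n \<Longrightarrow> x i > 0" and dom: "weighted_dominant n x A"
  shows "spectral_radius (map_mat complex_of_real
    (inv_mat (split_D A - split_L A) * split_U A)) < 1"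
proof -
  let ?T = "split_D A - split_L A" and ?c = "map_mat complex_of_real"
  let ?G = "inv_mat ?T * split_U A"
  have T: "?T \<in> carrier_mat n n" and U: "split_U A \<in> carrier_mat n n"
    using A by (auto simp: split_D_def split_L_def split_U_def)
  note inv = split_D_minus_L_inverse[OF A weighted_dominant_diag_nonzero[OF dom x]]
  have G: "?c ?G \<in> carrier_mat n n"
    using inv(1) U by simp
  from spectral_radius_mem_max(1)[OF G n]
  obtain e v where e: "spectral_radius (?c ?G) = cmod e" and ev: "eigenvector (?c ?G) v e"
    by (auto simp: spectrum_def eigenvalue_def)
  from ev G have v: "v \<in> carrier_vec n" "v \<noteq> 0\<^sub>v n" and Gv: "?c ?G *\<^sub>v v = e \<cdot>\<^sub>v v"
    unfolding eigenvector_def by auto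
  have "?T * ?G = split_U A"
    using inv T U by (simp flip: assoc_mult_mat[OF T inv(1) U])
  then have "?c (split_U A) = ?c ?T * ?c ?G"
    using of_real_hom.mat_hom_mult[OF T, of ?G n] inv(1) U by simp
  then have "?c (split_U A) *\<^sub>v v = ?c ?T *\<^sub>v (?c ?G *\<^sub>v v)"
    using T G v by (simp add: assoc_mult_mat_vec[of _ n n _ n])
  also have "\<dots> = e \<cdot>\<^sub>v (?c ?T *\<^sub>v v)"
    using T v unfolding Gv by (intro mult_mat_vec) auto
  finally show ?thesis
    using gauss_seidel_eigenvalue_norm_less_1[OF A v x dom] e by simp
qed

section \<open>The preconditioner preserves dominance\<close>

text \<open>Write \<open>c = b\<^sub>i\<^sub>,\<^sub>i\<^sub>+\<^sub>1\<close>. Off the columns \<open>i\<close> and \<open>i + 1\<close>, the triangle inequality bounds the new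
  entries by \<open>b\<^sub>i\<^sub>j + c b\<^sub>i\<^sub>+\<^sub>1\<^sub>,\<^sub>j\<close>. In column \<open>i + 1\<close> nothing is lost, because \<open>b\<^sub>i\<^sub>+\<^sub>1\<^sub>,\<^sub>i\<^sub>+\<^sub>1 \<le> 1\<close> makes
  the new entry \<open>c (1 - b\<^sub>i\<^sub>+\<^sub>1\<^sub>,\<^sub>i\<^sub>+\<^sub>1)\<close> nonnegative: the diagonal of row \<open>i + 1\<close> counts in full
  against its off-diagonal entries. The two strict inequalities for the rows \<open>i\<close> and \<open>i + 1\<close> therefore
  add up to the one for the new row.\<close>

lemma weighted_dominant_precond:
  fixes B :: "real mat"
  assumes x: "\<And>i. i < n \<Longrightarrow> x i > 0" and dom: "weighted_dominant n x B"
    and nonneg: "\<And>i j. i < n \<Longrightarrow> j < n \<Longrightarrow> B $$ (i, j) \<ge> 0"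
    and diag: "\<And>i. i < n \<Longrightarrow> B $$ (i, i) \<le> 1"
    and entry: "\<And>i j. i < n \<Longrightarrow> j < n \<Longrightarrow> A $$ (i, j) =
      B $$ (i, j) - (if Suc i < n then B $$ (i, Suc i) * B $$ (Suc i, j) else 0)"
  shows "weighted_dominant n x A"
  unfolding weighted_dominant_def
proof (intro allI impI)
  fix i assume i: "i < n"
  have dom': "(\<Sum>j\<in>{..<n} - {k}. B $$ (k, j) * x j) < B $$ (k, k) * x k" if "k < n" for k
  proof -
    have "(\<Sum>j\<in>{..<n} - {k}. B $$ (k, j) * x j) = (\<Sum>j\<in>{..<n} - {k}. \<bar>B $$ (k, j)\<bar> * x j)"
      using nonneg that by (intro sum.cong) auto
    also have "\<dots> < \<bar>B $$ (k, k)\<bar> * x k"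
      using dom that by (simp add: weighted_dominant_def)
    finally show ?thesis using nonneg that by simp
  qed
  show "(\<Sum>j\<in>{..<n} - {i}. \<bar>A $$ (i, j)\<bar> * x j) < \<bar>A $$ (i, i)\<bar> * x i"
  proof (cases "Suc i < n")
    case False
    then have "(\<Sum>j\<in>{..<n} - {i}. \<bar>A $$ (i, j)\<bar> * x j) = (\<Sum>j\<in>{..<n} - {i}. B $$ (i, j) * x j)"
      using i nonneg entry by (intro sum.cong) auto
    then show ?thesis
      using False i nonneg entry dom'[OF i] by simp
  next
    case True
    let ?k = "Suc i" and ?J = "{..<n} - {i} - {Suc i}"
    define c where "c = B $$ (i, ?k)"
    have c: "c \<ge> 0" using nonneg i True by (simp add: c_def)
    have "(\<Sum>j\<in>{..<n} - {i}. \<bar>A $$ (i, j)\<bar> * x j) =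
        \<bar>A $$ (i, ?k)\<bar> * x ?k + (\<Sum>j\<in>?J. \<bar>A $$ (i, j)\<bar> * x j)"
      using True by (intro sum.remove) auto
    also have "A $$ (i, ?k) = c * (1 - B $$ (?k, ?k))"
      using entry[OF i True] True by (simp add: c_def algebra_simps)
    also have "\<bar>\<dots>\<bar> = c * (1 - B $$ (?k, ?k))"
      using c diag[OF True] by simp
    also have "(\<Sum>j\<in>?J. \<bar>A $$ (i, j)\<bar> * x j) \<le>
        (\<Sum>j\<in>?J. B $$ (i, j) * x j + c * (B $$ (?k, j) * x j))"
    proof (rule sum_mono)
      fix j assume "j \<in> ?J"
      then have j: "j < n" by simp
      have "\<bar>A $$ (i, j)\<bar> \<le> B $$ (i, j) + c * B $$ (?k, j)"
        using entry[OF i j] True nonneg[OF i j] c nonneg[OF True j]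
        by (auto simp: abs_le_iff c_def add_nonneg_nonneg)
      from mult_right_mono[OF this less_imp_le[OF x[OF j]]]
      show "\<bar>A $$ (i, j)\<bar> * x j \<le> B $$ (i, j) * x j + c * (B $$ (?k, j) * x j)"
        by (simp add: algebra_simps)
    qed
    also have "\<dots> = (\<Sum>j\<in>?J. B $$ (i, j) * x j) + c * (\<Sum>j\<in>?J. B $$ (?k, j) * x j)"
      by (simp add: sum.distrib sum_distrib_left)
    also have "(\<Sum>j\<in>?J. B $$ (i, j) * x j) = (\<Sum>j\<in>{..<n} - {i}. B $$ (i, j) * x j) - c * x ?k"
      using True sum.remove[of "{..<n} - {i}" ?k "\<lambda>j. B $$ (i, j) * x j"] by (simp add: c_def)
    also have "?J = {..<n} - {?k} - {i}"
      by auto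
    also have "(\<Sum>j\<in>{..<n} - {?k} - {i}. B $$ (?k, j) * x j) =
        (\<Sum>j\<in>{..<n} - {?k}. B $$ (?k, j) * x j) - B $$ (?k, i) * x i"
      using i sum.remove[of "{..<n} - {?k}" i "\<lambda>j. B $$ (?k, j) * x j"]
      by simp
    finally have "(\<Sum>j\<in>{..<n} - {i}. \<bar>A $$ (i, j)\<bar> * x j) \<le>
        c * (1 - B $$ (?k, ?k)) * x ?k + ((\<Sum>j\<in>{..<n} - {i}. B $$ (i, j) * x j) - c * x ?k
        + c * ((\<Sum>j\<in>{..<n} - {?k}. B $$ (?k, j) * x j) - B $$ (?k, i) * x i))"
      by simp
    also have "\<dots> < c * (1 - B $$ (?k, ?k)) * x ?k + (B $$ (i, i) * x i - c * x ?k
        + c * (B $$ (?k, ?k) * x ?k - B $$ (?k, i) * x i))"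
      using dom'[OF i] dom'[OF True] c
      by (intro add_strict_left_mono add_less_le_mono mult_left_mono) auto
    also have "\<dots> = A $$ (i, i) * x i"
      unfolding entry[OF i i] using True by (simp add: c_def algebra_simps)
    also have "\<dots> \<le> \<bar>A $$ (i, i)\<bar> * x i"
      using x[OF i] by (intro mult_right_mono) auto
    finally show ?thesis .
  qed
qed

section \<open>Dominance of the collocation matrix\<close>

text \<open>At a simple interior knot only one function of each of the degrees 0 and 1 is nonzero, with
  value 1, and two of degree 2, whose values add up to 1. The values are left in the form in which
  the last recursion step produces them: the comparison of the middle value with its neighbours
  uses its two summands separately.\<close>

lemma bspline_3_at_knot:
  fixes u :: "int \<Rightarrow> real"
  assumes mono: "mono u" and lt: "u (i - 1) < u i" "u i < u (i + 1)"
  shows "bspline u 3 (i - 3) (u i) =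
      (u (i + 1) - u i) / (u (i + 1) - u (i - 2)) * ((u (i + 1) - u i) / (u (i + 1) - u (i - 1)))"
    and "bspline u 3 (i - 2) (u i) =
      (u i - u (i - 2)) / (u (i + 1) - u (i - 2)) * ((u (i + 1) - u i) / (u (i + 1) - u (i - 1)))
      + (u (i + 2) - u i) / (u (i + 2) - u (i - 1)) * ((u i - u (i - 1)) / (u (i + 1) - u (i - 1)))"
    and "bspline u 3 (i - 1) (u i) =
      (u i - u (i - 1)) / (u (i + 2) - u (i - 1)) * ((u i - u (i - 1)) / (u (i + 1) - u (i - 1)))"
proof -
  have 0: "bspline u 0 j (u i) = (if j = i then 1 else 0)" for j
  proof -
    have "u (j + 1) \<le> u i" if "j < i" using that by (intro monoD[OF mono]) simp
    moreover have "u (i + 1) \<le> u j" if "i < j" using that by (intro monoD[OF mono]) simp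
    ultimately show ?thesis using lt by (cases j i rule: linorder_cases) auto
  qed
  have 1: "bspline u 1 j (u i) = (if j = i - 1 then 1 else 0)" for j
    using lt by (auto simp: 0 add.commute simp del: bspline.simps(1))
  have 2: "bspline u 2 j (u i) = (if j = i - 1 then (u i - u (i - 1)) / (u (i + 1) - u (i - 1))
      else if j = i - 2 then (u (i + 1) - u i) / (u (i + 1) - u (i - 1)) else 0)" for j
    unfolding numeral_2_eq_2 bspline.simps(2)[of u "Suc 0"]
    using 1 by (auto simp del: bspline.simps simp: algebra_simps)
  note 3 = bspline.simps(2)[of u 2, folded numeral_3_eq_3[unfolded numeral_2_eq_2[symmetric]]]
  show "bspline u 3 (i - 3) (u i) =
      (u (i + 1) - u i) / (u (i + 1) - u (i - 2)) * ((u (i + 1) - u i) / (u (i + 1) - u (i - 1)))"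
    using 3[of "i - 3" "u i"] by (simp add: 2 algebra_simps del: bspline.simps)
  show "bspline u 3 (i - 2) (u i) =
      (u i - u (i - 2)) / (u (i + 1) - u (i - 2)) * ((u (i + 1) - u i) / (u (i + 1) - u (i - 1)))
      + (u (i + 2) - u i) / (u (i + 2) - u (i - 1)) * ((u i - u (i - 1)) / (u (i + 1) - u (i - 1)))"
    using 3[of "i - 2" "u i"] by (simp add: 2 algebra_simps del: bspline.simps)
  show "bspline u 3 (i - 1) (u i) =
      (u i - u (i - 1)) / (u (i + 2) - u (i - 1)) * ((u i - u (i - 1)) / (u (i + 1) - u (i - 1)))"
    using 3[of "i - 1" "u i"] by (simp add: 2 algebra_simps del: bspline.simps)
qed

text \<open>Clamping the index to \<open>1, \<dots>, n\<close> reduces monotonicity of the knots to that of the parameters,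
  without case distinctions.\<close>

lemma knot_eq_clamp: "n \<ge> 1 \<Longrightarrow> knot n t i = t (nat (max 1 (min (int n) i)))"
  by (auto simp: knot_def max_def min_def)

lemma mono_knot:
  assumes "n \<ge> 1" "strict_mono_on {1..n} t"
  shows "mono (knot n t)"
proof (rule monoI)
  fix i j :: int assume "i \<le> j"
  then show "knot n t i \<le> knot n t j"
    unfolding knot_eq_clamp[OF assms(1)] using assms(1)
    by (intro strict_mono_on_leD[OF assms(2)]) auto
qed

lemma knot_strict_mono:
  assumes "n \<ge> 2" "strict_mono_on {1..n} t" "i < j" "i < int n" "1 < j"
  shows "knot n t i < knot n t j"
proof -
  have "n \<ge> 1" using assms(1) by simp
  then show ?thesis
    unfolding knot_eq_clamp[OF \<open>n \<ge> 1\<close>] using assms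
    by (intro strict_mono_onD[OF assms(2)]) auto
qed

text \<open>The numbers \<open>u0, \<dots>, u4\<close> stand for the knots \<open>t (i - 2), \<dots>, t (i + 2)\<close>, and \<open>a\<close>, \<open>d\<close>, \<open>c\<close> for
  row \<open>i\<close> of the collocation matrix. With the weights \<open>u2 - u0\<close>, \<open>u3 - u1\<close>, \<open>u4 - u2\<close> the
  quotient of \<open>a (u2 - u0)\<close> and the first summand of \<open>d (u3 - u1)\<close> is
  \<open>(u3 - u2) / (u3 - u1) = p < 1\<close>, and on the other side it is \<open>q < 1\<close>. The bound \<open>d \<le> 1\<close> holds since
  \<open>d\<close> is a combination of \<open>p\<close> and \<open>q\<close>, whose sum is 1, with coefficients at most 1.\<close>

lemma bspline_row_dominant:
  fixes u0 u1 u2 u3 u4 :: real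
  assumes "u0 \<le> u1" "u1 < u2" "u2 < u3" "u3 \<le> u4"
  defines "p \<equiv> (u3 - u2) / (u3 - u1)" and "q \<equiv> (u2 - u1) / (u3 - u1)"
  defines "a \<equiv> (u3 - u2) / (u3 - u0) * p"
    and "d \<equiv> (u2 - u0) / (u3 - u0) * p + (u4 - u2) / (u4 - u1) * q"
    and "c \<equiv> (u2 - u1) / (u4 - u1) * q"
  shows "a \<ge> 0" "c \<ge> 0" "0 \<le> d" "d \<le> 1"
    and "a * (u2 - u0) + c * (u4 - u2) < d * (u3 - u1)"
proof -
  have pq: "p > 0" "q > 0" "p + q = 1"
    using assms(1-4) by (auto simp: p_def q_def simp flip: add_divide_distrib)
  have f: "0 < (u2 - u0) / (u3 - u0)" "(u2 - u0) / (u3 - u0) \<le> 1"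
      "0 < (u4 - u2) / (u4 - u1)" "(u4 - u2) / (u4 - u1) \<le> 1"
    using assms(1-4) by (auto simp: divide_simps)
  show "a \<ge> 0" "c \<ge> 0" "0 \<le> d"
    using pq f assms(1-4) by (auto simp: a_def c_def d_def)
  have "d \<le> 1 * p + 1 * q"
    unfolding d_def using pq f by (intro add_mono mult_right_mono) auto
  then show "d \<le> 1" using pq by simp
  have "a * (u2 - u0) = (u2 - u0) / (u3 - u0) * p * (u3 - u2)"
    by (simp add: a_def)
  also have "\<dots> < (u2 - u0) / (u3 - u0) * p * (u3 - u1)"
    using assms(2) pq f by (intro mult_strict_left_mono mult_pos_pos) auto
  finally have 1: "a * (u2 - u0) < (u2 - u0) / (u3 - u0) * p * (u3 - u1)" .
  have "c * (u4 - u2) = (u4 - u2) / (u4 - u1) * q * (u2 - u1)"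
    by (simp add: c_def)
  also have "\<dots> < (u4 - u2) / (u4 - u1) * q * (u3 - u1)"
    using assms(3) pq f by (intro mult_strict_left_mono mult_pos_pos) auto
  finally have 2: "c * (u4 - u2) < (u4 - u2) / (u4 - u1) * q * (u3 - u1)" .
  from add_strict_mono[OF 1 2] show "a * (u2 - u0) + c * (u4 - u2) < d * (u3 - u1)"
    by (simp add: d_def distrib_right)
qed

lemma collocation_mat_interior_row:
  assumes "n \<ge> 1" "strict_mono_on {1..n} t" "0 < k" "Suc k < n"
  defines "B \<equiv> collocation_mat n t" and "x \<equiv> \<lambda>k. knot n t (int k + 2) - knot n t (int k)"
  shows "B $$ (k, k - 1) \<ge> 0" "B $$ (k, k + 1) \<ge> 0" "0 \<le> B $$ (k, k)" "B $$ (k, k) \<le> 1"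
    and "B $$ (k, k - 1) * x (k - 1) + B $$ (k, k + 1) * x (k + 1) < B $$ (k, k) * x k"
proof -
  \<comment> \<open>The row with 0-based index \<open>k\<close> belongs to the parameter \<open>t (k + 1)\<close>.\<close>
  define i where "i = int k + 1"
  let ?u = "knot n t"
  have t: "t (Suc k) = ?u i"
    using assms(3,4) by (simp add: i_def knot_def nat_add_distrib)
  note mono = mono_knot[OF assms(1,2)]
  have lt: "?u (i - 1) < ?u i" "?u i < ?u (i + 1)"
    using assms(3,4) by (auto intro!: knot_strict_mono[OF _ assms(2)] simp: i_def)
  have le: "?u (i - 2) \<le> ?u (i - 1)" "?u (i + 1) \<le> ?u (i + 2)"
    by (auto intro!: monoD[OF mono])
  have B: "B $$ (k, k - 1) = bspline ?u 3 (i - 3) (?u i)"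
      "B $$ (k, k) = bspline ?u 3 (i - 2) (?u i)"
      "B $$ (k, k + 1) = bspline ?u 3 (i - 1) (?u i)"
    using assms(3,4)
    by (auto simp: B_def collocation_mat_def collocation_entry_def t[unfolded i_def] i_def
        simp del: bspline.simps)
  have x: "x (k - 1) = ?u i - ?u (i - 2)" "x k = ?u (i + 1) - ?u (i - 1)"
      "x (k + 1) = ?u (i + 2) - ?u i"
    using assms(3) by (auto simp: x_def i_def of_nat_diff algebra_simps)
  note row = bspline_row_dominant[OF le(1) lt le(2)]
  show "B $$ (k, k - 1) \<ge> 0" "B $$ (k, k + 1) \<ge> 0" "0 \<le> B $$ (k, k)" "B $$ (k, k) \<le> 1"
    "B $$ (k, k - 1) * x (k - 1) + B $$ (k, k + 1) * x (k + 1) < B $$ (k, k) * x k"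
    unfolding B x bspline_3_at_knot[OF mono lt] by (rule row)+
qed

lemma collocation_mat_boundary_row:
  assumes "k = 0 \<or> Suc k = n" "k < n" "j < n"
  shows "collocation_mat n t $$ (k, j) = (if j = k then 1 else 0)"
  using assms by (auto simp: collocation_mat_def collocation_entry_def)

lemma collocation_mat_off_band:
  assumes "k < n" "j < n" "j \<noteq> k" "j + 1 \<noteq> k" "j \<noteq> k + 1"
  shows "collocation_mat n t $$ (k, j) = 0"
  using assms by (auto simp: collocation_mat_def collocation_entry_def)

lemma collocation_mat_bounds:
  assumes "n \<ge> 1" "strict_mono_on {1..n} t" "k < n" "j < n"
  shows "collocation_mat n t $$ (k, j) \<ge> 0" and "collocation_mat n t $$ (k, k) \<le> 1"
proof -
  let ?B = "collocation_mat n t"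
  have "?B $$ (k, j) \<ge> 0 \<and> ?B $$ (k, k) \<le> 1"
  proof (cases "k = 0 \<or> Suc k = n")
    case True
    then show ?thesis using assms(3,4) by (auto simp: collocation_mat_boundary_row)
  next
    case False
    then have "0 < k" "Suc k < n" using assms(3) by auto
    note row = collocation_mat_interior_row[OF assms(1,2) this]
    consider "j = k" | "j = k - 1" | "j = k + 1" | "j \<noteq> k" "j + 1 \<noteq> k" "j \<noteq> k + 1"
      by linarith
    then show ?thesis
      by cases (use row collocation_mat_off_band[OF assms(3,4)] in auto)
  qed
  then show "?B $$ (k, j) \<ge> 0" and "?B $$ (k, k) \<le> 1" by auto
qed

lemma knot_gap_pos:
  assumes "n \<ge> 2" "strict_mono_on {1..n} t" "k < n"
  shows "0 < knot n t (int k + 2) - knot n t (int k)"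
  using knot_strict_mono[OF assms(1,2), of "int k" "int k + 2"] assms by simp

lemma collocation_mat_weighted_dominant:
  assumes n: "n \<ge> 2" and t: "strict_mono_on {1..n} t"
  shows "weighted_dominant n (\<lambda>k. knot n t (int k + 2) - knot n t (int k)) (collocation_mat n t)"
  unfolding weighted_dominant_def
proof (intro allI impI)
  fix k assume k: "k < n"
  let ?B = "collocation_mat n t"
  define x where "x = (\<lambda>k. knot n t (int k + 2) - knot n t (int k))"
  have x: "x k > 0" using knot_gap_pos[OF n t k] by (simp add: x_def)
  have n1: "n \<ge> 1" using n by simp
  have "(\<Sum>j\<in>{..<n} - {k}. \<bar>?B $$ (k, j)\<bar> * x j) < \<bar>?B $$ (k, k)\<bar> * x k"
  proof (cases "k = 0 \<or> Suc k = n")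
    case True
    then have "(\<Sum>j\<in>{..<n} - {k}. \<bar>?B $$ (k, j)\<bar> * x j) = 0"
      using k by (intro sum.neutral) (auto simp: collocation_mat_boundary_row)
    then show ?thesis
      using True k x by (auto simp: collocation_mat_boundary_row)
  next
    case False
    then have k': "0 < k" "Suc k < n" using k by auto
    note row = collocation_mat_interior_row[OF n1 t this]
    have "(\<Sum>j\<in>{..<n} - {k}. \<bar>?B $$ (k, j)\<bar> * x j) =
        (\<Sum>j\<in>{k - 1, k + 1}. \<bar>?B $$ (k, j)\<bar> * x j)"
      using k k' by (intro sum.mono_neutral_right) (auto simp: collocation_mat_off_band)
    also have "\<dots> = ?B $$ (k, k - 1) * x (k - 1) + ?B $$ (k, k + 1) * x (k + 1)"
      using row(1,2) by simp
    also have "\<dots> < ?B $$ (k, k) * x k"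
      using row(5) by (simp add: x_def)
    also have "\<dots> \<le> \<bar>?B $$ (k, k)\<bar> * x k"
      using x by (intro mult_right_mono) auto
    finally show ?thesis .
  qed
  then show "(\<Sum>j\<in>{..<n} - {k}. \<bar>?B $$ (k, j)\<bar> * (knot n t (int j + 2) - knot n t (int j)))
      < \<bar>?B $$ (k, k)\<bar> * (knot n t (int k + 2) - knot n t (int k))"
    by (simp add: x_def)
qed

text \<open>For a single parameter all the knots coincide, so the knot differences vanish; the matrix is then
  the number 1 and any positive weight will do.\<close>

lemma collocation_mat_dominant_weight:
  assumes n: "n \<ge> 1" and t: "strict_mono_on {1..n} t"
  obtains x where "\<And>k. k < n \<Longrightarrow> x k > 0" "weighted_dominant n x (collocation_mat n t)"
proof (cases "n = 1")
  case True
  then have "weighted_dominant n (\<lambda>_. 1) (collocation_mat n t)"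
    by (auto simp: weighted_dominant_def collocation_mat_boundary_row lessThan_Suc)
  then show ?thesis by (intro that[of "\<lambda>_. 1"]) auto
next
  case False
  then have n2: "n \<ge> 2" using n by simp
  show ?thesis
    by (rule that[OF knot_gap_pos[OF n2 t] collocation_mat_weighted_dominant[OF n2 t]])
qed

section \<open>Convergence of the preconditioned iteration\<close>

lemma precond_collocation_entry:
  fixes t :: "nat \<Rightarrow> real"
  assumes "i < n" "j < n"
  defines "B \<equiv> collocation_mat n t"
  shows "(precond_mat n t * B) $$ (i, j) =
    B $$ (i, j) - (if Suc i < n then B $$ (i, Suc i) * B $$ (Suc i, j) else 0)"
proof -
  have B: "B \<in> carrier_mat n n" and S: "super_diag_mat n t \<in> carrier_mat n n"
    by (auto simp: B_def collocation_mat_def super_diag_mat_def)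
  have "(super_diag_mat n t * B) $$ (i, j) =
      (\<Sum>l<n. super_diag_mat n t $$ (i, l) * B $$ (l, j))"
    using assms(1,2) B S by (simp add: scalar_prod_def lessThan_atLeast0)
  also have "\<dots> = (\<Sum>l<n. if l = Suc i then - (B $$ (i, l) * B $$ (l, j)) else 0)"
    using assms(1) by (intro sum.cong) (auto simp: super_diag_mat_def B_def)
  also have "\<dots> = - (if Suc i < n then B $$ (i, Suc i) * B $$ (Suc i, j) else 0)"
    by (simp add: sum.delta)
  finally show ?thesis
    using assms(1,2) B S unfolding precond_mat_def
    by (simp add: add_mult_distrib_mat[OF one_carrier_mat S B])
qed

theorem theorem5:
  fixes n d :: nat and t :: "nat \<Rightarrow> real"
    and B Q QB D L U p :: "real mat" and P :: "nat \<Rightarrow> real mat"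
  assumes "n \<ge> 1" and "strict_mono_on {1..n} t"
    and "B = collocation_mat n t" and "Q = precond_mat n t" and "QB = Q * B"
    and "D = split_D QB" and "L = split_L QB" and "U = split_U QB"
    and "d \<in> {2, 3}" and "p \<in> carrier_mat n d" and "P 0 \<in> carrier_mat n d"
    and "\<And>k. P (Suc k) = (inv_mat (D - L) * U) * P k + (inv_mat (D - L) * Q) * p"
  shows "spectral_radius (map_mat complex_of_real (inv_mat (D - L) * U)) < 1"
proof -
  note n = assms(1) and t = assms(2)
  obtain x where x: "\<And>k. k < n \<Longrightarrow> x k > 0" "weighted_dominant n x (collocation_mat n t)"
    using collocation_mat_dominant_weight[OF n t] by blast
  have "weighted_dominant n x (precond_mat n t * collocation_mat n t)"
    by (rule weighted_dominant_precond[OF x])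
      (auto simp: collocation_mat_bounds[OF n t] precond_collocation_entry)
  moreover have "precond_mat n t * collocation_mat n t \<in> carrier_mat n n"
    by (auto simp: precond_mat_def super_diag_mat_def collocation_mat_def)
  ultimately show ?thesis
    using gauss_seidel_spectral_radius_less_1 n x(1) unfolding assms(3-8) by auto
qed

end
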